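(* Let $X$ be a Banach lattice and $(X_k)$ a bidecomposition in $X$. The following are equivalent: (1) $(X_k)$ is absolute; (2) for each $x\in[X_k]$ there exists $u\ge0$ in $X$ such that $|P_n^\sigma x|\le u$ for all $n\in\mathbb N$ and all permutations $\sigma$ of $\mathbb N$.
   Context: For a sequence $(X_k)$ of closed non-zero subspaces of a Banach lattice $X$, $[X_k]$ is the closed linear span of $\bigcup_kX_k$. $(X_k)$ is a Schauder decomposition of $[X_k]$ if every $x\in[X_k]$ has a unique norm convergent expansion $x=\sum_{k=1}^\infty x_k$ with $x_k\in X_k$. A Schauder decomposition $(X_k)$ is a bidecomposition if there is $M\ge1$ such that $\bigl\|\bigvee_{n=1}^m|\sum_{k=1}^nx_k|\bigr\|\le M\bigl\|\sum_{k=1}^mx_k\bigr\|$ for all $m\in\mathbb N$ and all $x_k\in X_k$, $k=1,\dots,m$ (equivalently, for every $x\in [X_k]$ the partial sums of its expansion converge to $x$ in order in $X$; equivalently, they are order bounded in $X$). $(X_k)$ is absolute if there is $A\ge1$ such that $\bigl\|\sum_{k=1}^m|x_k|\bigr\|\le A\bigl\|\sum_{k=1}^mx_k\bigr\|$ for all $m\in\mathbb N$ and all $x_k\in X_k$, $k=1,\dots,m$. For a permutation $\sigma$ of $\mathbb N$ and $x=\sum_{k=1}^\infty x_k\in[X_k]$ with $x_k\in X_k$, $P_n^\sigma$ denotes the $n$-th canonical projection associated with the permuted sequence $(X_{\sigma(k)})$, that is, $P_n^\sigma x=\sum_{i=1}^nx_{\sigma(i)}$. *)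

theory Defs
  imports "HOL-Analysis.Analysis" "HOL-Library.Lattice_Algebras"
begin

class banach_lattice = banach + ordered_real_vector + lattice_ab_group_add_abs +
  assumes abs_le_abs_imp_norm_le: "\<bar>x\<bar> \<le> \<bar>y\<bar> \<Longrightarrow> norm x \<le> norm y"

instance real :: banach_lattice
  by standard (metis real_norm_def)

text \<open>
  Sequences of subspaces are indexed from \<open>0\<close>, so that \<open>\<Sum>k<n\<close> runs over the first \<open>n\<close> terms.
\<close>

definition closed_span :: "(nat \<Rightarrow> 'a::real_normed_vector set) \<Rightarrow> 'a set" where
  "closed_span X = closure (span (\<Union>k. X k))"

definition is_expansion :: "(nat \<Rightarrow> 'a::real_normed_vector set) \<Rightarrow> 'a \<Rightarrow> (nat \<Rightarrow> 'a) \<Rightarrow> bool" where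
  "is_expansion X x y \<longleftrightarrow> (\<forall>k. y k \<in> X k) \<and> y sums x"

definition schauder_decomposition :: "(nat \<Rightarrow> 'a::real_normed_vector set) \<Rightarrow> bool" where
  "schauder_decomposition X \<longleftrightarrow>
     (\<forall>k. subspace (X k) \<and> closed (X k) \<and> X k \<noteq> {0}) \<and>
     (\<forall>x\<in>closed_span X. \<exists>!y. is_expansion X x y)"

definition bidecomposition :: "(nat \<Rightarrow> 'a::banach_lattice set) \<Rightarrow> bool" where
  "bidecomposition X \<longleftrightarrow> schauder_decomposition X \<and>
     (\<exists>M\<ge>1. \<forall>m\<ge>1. \<forall>x. (\<forall>k<m. x k \<in> X k) \<longrightarrow>
        norm (Sup_fin ((\<lambda>n. \<bar>\<Sum>k<n. x k\<bar>) ` {1..m})) \<le> M * norm (\<Sum>k<m. x k))"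

definition absolute :: "(nat \<Rightarrow> 'a::banach_lattice set) \<Rightarrow> bool" where
  "absolute X \<longleftrightarrow>
     (\<exists>A\<ge>1. \<forall>m\<ge>1. \<forall>x. (\<forall>k<m. x k \<in> X k) \<longrightarrow>
        norm (\<Sum>k<m. \<bar>x k\<bar>) \<le> A * norm (\<Sum>k<m. x k))"

text \<open>
  The next two functions are meaningful only if \<open>X\<close> is a Schauder decomposition and
  \<open>x \<in> closed_span X\<close>.
\<close>

definition expansion :: "(nat \<Rightarrow> 'a::real_normed_vector set) \<Rightarrow> 'a \<Rightarrow> nat \<Rightarrow> 'a" where
  "expansion X x = (THE y. is_expansion X x y)"

definition perm_projection ::
  "(nat \<Rightarrow> 'a::real_normed_vector set) \<Rightarrow> (nat \<Rightarrow> nat) \<Rightarrow> nat \<Rightarrow> 'a \<Rightarrow> 'a" where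
  "perm_projection X \<sigma> n x = (\<Sum>i<n. expansion X x (\<sigma> i))"

lemma is_expansion_expansion:
  assumes "schauder_decomposition X" and "x \<in> closed_span X"
  shows "is_expansion X x (expansion X x)"
proof -
  have "\<exists>!y. is_expansion X x y"
    using assms by (simp add: schauder_decomposition_def)
  then show ?thesis
    unfolding expansion_def by (rule theI')
qed

end

theory Submission
  imports Defs
begin

text \<open>
  If the decomposition is absolute, \<open>u = (\<Sum>k. \<bar>x\<^sub>k\<bar>)\<close> converges and dominates every
  permuted partial sum. Conversely, order boundedness of all permuted partial sums bounds all the
  finite sums \<open>\<Sum>k\<in>F. x\<^sub>k\<close>, hence all signed sums; since \<open>\<Sum>k<m. \<bar>x\<^sub>k\<bar>\<close> is the supremum of
  the signed sums, the seminorms \<open>x \<mapsto> \<parallel>\<Sum>k<m. \<bar>x\<^sub>k\<bar>\<parallel>\<close> are pointwise bounded on \<open>[X\<^sub>k]\<close>,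
  and the uniform boundedness principle gives the constant of absoluteness.
\<close>

section \<open>Uniform boundedness for seminorms\<close>

text \<open>Baire category argument: the relatively closed sets \<open>F n\<close> cover the
  complete space \<open>S\<close>, so one of them contains a relative ball, which is moved to the
  origin and rescaled. All conditions are relative to \<open>S\<close>, since the seminorms applied
  later are built from \<open>expansion\<close>, which is meaningful only on
  \<open>closed_span X\<close>.\<close>

lemma seminorms_uniformly_bounded:
  fixes p :: "'i \<Rightarrow> 'a::banach \<Rightarrow> real"
  assumes S: "closed S" "subspace S"
    and cont: "\<And>i. continuous_on S (p i)"
    and triangle: "\<And>i x y. x \<in> S \<Longrightarrow> y \<in> S \<Longrightarrow> p i (x + y) \<le> p i x + p i y"
    and scale: "\<And>i c x. x \<in> S \<Longrightarrow> p i (c *\<^sub>R x) = \<bar>c\<bar> * p i x"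
    and bounded: "\<And>x. x \<in> S \<Longrightarrow> \<exists>B. \<forall>i. p i x \<le> B"
  shows "\<exists>C. \<forall>i. \<forall>x\<in>S. p i x \<le> C * norm x"
proof -
  define F where "F n = {x \<in> S. \<forall>i. p i x \<le> real n}" for n
  have F_closed: "closedin (top_of_set S) (F n)" for n
  proof -
    have "closedin (top_of_set S) (\<Inter>i. S \<inter> p i -` {..real n})"
      using cont by (intro closedin_INT continuous_closedin_preimage) auto
    moreover have "(\<Inter>i. S \<inter> p i -` {..real n}) = F n"
      by (auto simp: F_def)
    ultimately show ?thesis by simp
  qed
  have "(\<Union>n. F n) = S"
  proof
    show "S \<subseteq> (\<Union>n. F n)"
    proof
      fix x assume x: "x \<in> S"
      then obtain B where B: "\<forall>i. p i x \<le> B" using bounded by blast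
      obtain n where "B \<le> real n" using real_arch_simple by blast
      with B x have "x \<in> F n" unfolding F_def using order_trans by blast
      then show "x \<in> (\<Union>n. F n)" by blast
    qed
  qed (auto simp: F_def)
  \<comment> \<open>The union has interior \<open>S\<close>, which is nonempty, so by Baire the
    closed sets \<open>F n\<close> cannot all have empty interior.\<close>
  then have "top_of_set S interior_of \<Union>(range F) = S"
    using interior_of_topspace[of "top_of_set S"] by simp
  moreover have "S \<noteq> {}"
    using S subspace_0 by blast
  moreover have "completely_metrizable_space (top_of_set S)"
    using S(1) closed_closedin completely_metrizable_space_closedin
      completely_metrizable_space_euclidean by blast
  ultimately obtain n where "top_of_set S interior_of F n \<noteq> {}"
    using Baire_category_alt[of "top_of_set S" "range F"] F_closed by auto
  then obtain T a where "openin (top_of_set S) T" "T \<subseteq> F n" "a \<in> T"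
    by (auto simp: interior_of_def)
  then obtain r where r: "r > 0" "ball a r \<inter> S \<subseteq> F n" and a: "a \<in> S"
    unfolding openin_contains_ball by blast
  \<comment> \<open>Write \<open>y\<close> as \<open>(a + y) - a\<close>; both terms lie in the ball
    inside \<open>F n\<close>, which gives the factor 2.\<close>
  have small: "p i y \<le> 2 * real n" if "y \<in> S" "norm y < r" for i y
  proof -
    have "a + y \<in> ball a r \<inter> S" "a \<in> ball a r \<inter> S"
      using a S that r by (auto simp: dist_norm subspace_add)
    then have "p i (a + y) \<le> real n" "p i a \<le> real n"
      using r(2) unfolding F_def by blast+
    moreover have "p i y \<le> p i (a + y) + p i ((-1) *\<^sub>R a)"
      using triangle[of "a + y" "(-1) *\<^sub>R a" i] a that S(2)
      by (simp add: subspace_add subspace_neg)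
    ultimately show ?thesis using scale[OF a, of i "-1"] by simp
  qed
  have "p i x \<le> 4 * real n / r * norm x" if x: "x \<in> S" for i x
  proof (cases "x = 0")
    case True
    then show ?thesis using scale[OF x, of i 0] by simp
  next
    case False
    \<comment> \<open>This factor gives \<open>t *\<^sub>R x\<close> the norm \<open>r / 2\<close>,
      strictly inside the radius of \<open>small\<close>.\<close>
    define t where "t = r / (2 * norm x)"
    have t: "t > 0" using False r by (simp add: t_def)
    have "norm (t *\<^sub>R x) < r" using False r by (simp add: t_def)
    with small[of "t *\<^sub>R x" i] have "t * p i x \<le> 2 * real n"
      using t x S(2) by (simp add: scale subspace_scale)
    then have "p i x \<le> 2 * real n / t"
      using t by (simp add: field_simps)
    then show ?thesis using False r by (simp add: t_def field_simps)
  qed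
  then show ?thesis by blast
qed

section \<open>Banach lattices\<close>

lemma norm_le_of_abs_le:
  fixes x y :: "'a::banach_lattice"
  assumes "\<bar>x\<bar> \<le> y"
  shows "norm x \<le> norm y"
  using assms abs_ge_self[of y] order_trans by (blast intro: abs_le_abs_imp_norm_le)

text \<open>The reverse triangle inequality and monotonicity of the norm make the modulus
  1-Lipschitz.\<close>

lemma continuous_on_abs_lattice:
  fixes f :: "'b::topological_space \<Rightarrow> 'a::banach_lattice"
  assumes "continuous_on S f"
  shows "continuous_on S (\<lambda>x. \<bar>f x\<bar>)"
proof -
  have "norm (\<bar>y\<bar> - \<bar>x\<bar>) \<le> norm (y - x)" for x y :: 'a
    by (intro abs_le_abs_imp_norm_le abs_triangle_ineq3)
  then have "1-lipschitz_on UNIV (\<lambda>x::'a. \<bar>x\<bar>)"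
    by (intro lipschitz_onI) (auto simp: dist_norm)
  then have "continuous_on UNIV (\<lambda>x::'a. \<bar>x\<bar>)"
    by (rule lipschitz_on_continuous_on)
  then show ?thesis
    using assms continuous_on_compose2 by blast
qed

text \<open>The positive cone is the fixed-point set of the continuous modulus.\<close>

lemma closed_nonneg_lattice: "closed {x::'a::banach_lattice. 0 \<le> x}"
proof -
  have "{x::'a. 0 \<le> x} = {x. \<bar>x\<bar> = x}"
    by (auto simp: abs_of_nonneg dest: sym[of _ "\<bar>_\<bar>"]) (metis abs_ge_zero)
  then show ?thesis
    by (simp add: closed_Collect_eq continuous_on_abs_lattice)
qed

lemma sum_le_suminf_lattice:
  fixes f :: "nat \<Rightarrow> 'a::banach_lattice"
  assumes "summable f" and nonneg: "\<And>k. 0 \<le> f k"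
  shows "sum f {..<n} \<le> suminf f"
proof -
  have "(\<lambda>m. sum f {..<m} - sum f {..<n}) \<longlonglongrightarrow> suminf f - sum f {..<n}"
    using assms by (intro tendsto_intros summable_LIMSEQ)
  moreover have "eventually (\<lambda>m. sum f {..<m} - sum f {..<n} \<in> {x. 0 \<le> x}) sequentially"
    using eventually_ge_at_top[of n]
    by eventually_elim (auto intro!: sum_mono2 nonneg)
  ultimately have "suminf f - sum f {..<n} \<in> {x. 0 \<le> x}"
    by (rule Lim_in_closed_set[OF closed_nonneg_lattice _ trivial_limit_sequentially, rotated])
  then show ?thesis by simp
qed

text \<open>The inequality \<open>le\<close>, valid for every scalar, yields its own converse when
  applied to \<open>inverse c\<close>.\<close>

lemma abs_scaleR_lattice:
  fixes x :: "'a::banach_lattice"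
  shows "\<bar>c *\<^sub>R x\<bar> = \<bar>c\<bar> *\<^sub>R \<bar>x\<bar>"
proof -
  have pos: "\<bar>b *\<^sub>R y\<bar> \<le> b *\<^sub>R \<bar>y\<bar>" if "b \<ge> 0" for b and y :: 'a
  proof (rule abs_leI)
    show "b *\<^sub>R y \<le> b *\<^sub>R \<bar>y\<bar>"
      using that by (intro scaleR_left_mono abs_ge_self)
    show "- (b *\<^sub>R y) \<le> b *\<^sub>R \<bar>y\<bar>"
      using scaleR_left_mono[OF abs_ge_minus_self that, of y] by simp
  qed
  have le: "\<bar>b *\<^sub>R y\<bar> \<le> \<bar>b\<bar> *\<^sub>R \<bar>y\<bar>" for b and y :: 'a
    using pos[of "\<bar>b\<bar>" y] by (cases "b \<ge> 0") auto
  show ?thesis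
  proof (cases "c = 0")
    case False
    have "\<bar>x\<bar> = \<bar>inverse c *\<^sub>R (c *\<^sub>R x)\<bar>" using False by simp
    also have "\<dots> \<le> \<bar>inverse c\<bar> *\<^sub>R \<bar>c *\<^sub>R x\<bar>" by (rule le)
    finally have "\<bar>c\<bar> *\<^sub>R \<bar>x\<bar> \<le> \<bar>c\<bar> *\<^sub>R (\<bar>inverse c\<bar> *\<^sub>R \<bar>c *\<^sub>R x\<bar>)"
      by (rule scaleR_left_mono) simp
    also have "\<dots> = \<bar>c *\<^sub>R x\<bar>" using False by (simp flip: abs_mult)
    finally show ?thesis using le by (intro antisym)
  qed simp
qed

text \<open>Here \<open>F\<close> is the set of indices with sign plus. In the induction the new
  index \<open>k\<close> gets either sign, so the hypothesis for \<open>K\<close> applies with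
  \<open>v - f k\<close> and with \<open>v + f k\<close>; together they bound both
  \<open>f k\<close> and \<open>- f k\<close>. This is why \<open>v\<close> must be
  arbitrary.\<close>

lemma sum_abs_le_of_signed_sums_le:
  fixes f :: "'b \<Rightarrow> 'a::lattice_ab_group_add_abs"
  assumes "finite K" and "\<And>F. F \<subseteq> K \<Longrightarrow> sum f F - sum f (K - F) \<le> v"
  shows "(\<Sum>k\<in>K. \<bar>f k\<bar>) \<le> v"
  using assms
proof (induction K arbitrary: v rule: finite_induct)
  case empty
  then show ?case by simp
next
  case (insert k K)
  have "(\<Sum>j\<in>K. \<bar>f j\<bar>) \<le> v - f k"
  proof (rule insert.IH)
    fix F assume F: "F \<subseteq> K"
    then have "k \<notin> F" "finite F" "insert k K - insert k F = K - F"
      using insert.hyps finite_subset by auto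
    then show "sum f F - sum f (K - F) \<le> v - f k"
      using insert.prems[of "insert k F"] F by (simp add: algebra_simps subset_insertI2)
  qed
  moreover have "(\<Sum>j\<in>K. \<bar>f j\<bar>) \<le> v + f k"
  proof (rule insert.IH)
    fix F assume F: "F \<subseteq> K"
    then have "insert k K - F = insert k (K - F)" "k \<notin> K - F" "finite (K - F)"
      using insert.hyps by auto
    then show "sum f F - sum f (K - F) \<le> v + f k"
      using insert.prems[of F] F by (simp add: algebra_simps subset_insertI2)
  qed
  ultimately have "\<bar>f k\<bar> \<le> v - (\<Sum>j\<in>K. \<bar>f j\<bar>)"
    by (intro abs_leI) (simp_all add: algebra_simps)
  then show ?case
    using insert.hyps by (simp add: algebra_simps)
qed

text \<open>A signed sum is the difference of two subset sums, each of modulus at most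
  \<open>u\<close>; hence the bound \<open>u + u\<close>.\<close>

lemma sum_abs_le_of_subset_sums_le:
  fixes f :: "'b \<Rightarrow> 'a::lattice_ab_group_add_abs"
  assumes "finite K" and le: "\<And>F. F \<subseteq> K \<Longrightarrow> \<bar>sum f F\<bar> \<le> u"
  shows "(\<Sum>k\<in>K. \<bar>f k\<bar>) \<le> u + u"
proof (rule sum_abs_le_of_signed_sums_le)
  fix F assume "F \<subseteq> K"
  then have "sum f F \<le> u" "- sum f (K - F) \<le> u"
    using le[of F] le[of "K - F"] abs_ge_self abs_ge_minus_self order_trans by blast+
  then show "sum f F - sum f (K - F) \<le> u + u"
    using add_mono by fastforce
qed fact

section \<open>Schauder decompositions\<close>

text \<open>Makes every finite subset sum a partial sum of some permuted series. A bijection onto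
  \<open>F\<close> is glued to one between the two infinite complements, obtained by enumerating
  both.\<close>

lemma ex_bij_image_lessThan_card:
  fixes F :: "nat set"
  assumes "finite F"
  shows "\<exists>\<sigma>. bij \<sigma> \<and> \<sigma> ` {..<card F} = F"
proof -
  let ?n = "card F"
  obtain f where f: "bij_betw f {..<?n} F"
    using ex_bij_betw_nat_finite[OF assms] by (auto simp: atLeast0LessThan)
  have "infinite {?n..}" "infinite (- F)"
    using assms by (auto simp: infinite_Ici Compl_eq_Diff_UNIV)
  then obtain g where g: "bij_betw g {?n..} (- F)"
    using bij_betw_trans[OF bij_betw_inv_into[OF bij_enumerate] bij_enumerate] by blast
  define \<sigma> where "\<sigma> i = (if i < ?n then f i else g i)" for i
  have f': "bij_betw \<sigma> {..<?n} F"
    using f by (rule bij_betw_cong[THEN iffD1, rotated]) (simp add: \<sigma>_def)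
  have g': "bij_betw \<sigma> {?n..} (- F)"
    using g by (rule bij_betw_cong[THEN iffD1, rotated]) (simp add: \<sigma>_def)
  have "{..<?n} \<union> {?n..} = UNIV" by auto
  then have "bij \<sigma>"
    using bij_betw_combine[OF f' g'] by simp
  then show ?thesis using f' bij_betw_imp_surj_on by blast
qed

lemma subspace_closure:
  fixes S :: "'a::real_normed_vector set"
  assumes "subspace S"
  shows "subspace (closure S)"
proof (rule subspaceI)
  show "0 \<in> closure S"
    using subspace_0[OF assms] closure_subset by blast
next
  fix x y assume "x \<in> closure S" "y \<in> closure S"
  then obtain f g where "\<And>n. f n \<in> S" "f \<longlonglongrightarrow> x" "\<And>n. g n \<in> S" "g \<longlonglongrightarrow> y"
    unfolding closure_sequential by blast
  then show "x + y \<in> closure S"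
    unfolding closure_sequential
    by (intro exI[of _ "\<lambda>n. f n + g n"]) (auto intro: tendsto_add subspace_add[OF assms])
next
  fix c x assume "x \<in> closure S"
  then obtain f where "\<And>n. f n \<in> S" "f \<longlonglongrightarrow> x"
    unfolding closure_sequential by blast
  then show "c *\<^sub>R x \<in> closure S"
    unfolding closure_sequential
    by (intro exI[of _ "\<lambda>n. c *\<^sub>R f n"])
      (auto intro: tendsto_scaleR subspace_scale[OF assms])
qed

lemma subspace_closed_span: "subspace (closed_span X)"
  unfolding closed_span_def by (intro subspace_closure subspace_span)

lemma closed_closed_span: "closed (closed_span X)"
  by (simp add: closed_span_def)

lemma sum_mem_closed_span:
  assumes "\<And>k. k \<in> I \<Longrightarrow> x k \<in> X k"
  shows "sum x I \<in> closed_span X"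
proof -
  have "sum x I \<in> span (\<Union>k. X k)"
    using assms by (intro span_sum span_base) auto
  then show ?thesis
    unfolding closed_span_def using closure_subset by blast
qed

context
  fixes X :: "nat \<Rightarrow> 'a::real_normed_vector set"
  assumes X: "schauder_decomposition X"
begin

lemma schauder_subspace: "subspace (X k)"
  using X by (simp add: schauder_decomposition_def)

lemma expansion_mem: "x \<in> closed_span X \<Longrightarrow> expansion X x k \<in> X k"
  using is_expansion_expansion[OF X] by (simp add: is_expansion_def)

lemma expansion_sums: "x \<in> closed_span X \<Longrightarrow> expansion X x sums x"
  using is_expansion_expansion[OF X] by (simp add: is_expansion_def)

lemma expansion_unique:
  assumes "x \<in> closed_span X" "\<And>k. y k \<in> X k" "y sums x"
  shows "expansion X x = y"
  using X assms is_expansion_expansion[OF X assms(1)]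
  unfolding schauder_decomposition_def is_expansion_def by blast

lemma expansion_add:
  assumes "x \<in> closed_span X" "y \<in> closed_span X"
  shows "expansion X (x + y) = (\<lambda>k. expansion X x k + expansion X y k)"
  using assms
  by (intro expansion_unique sums_add expansion_sums subspace_add[OF schauder_subspace]
      expansion_mem subspace_add[OF subspace_closed_span])

lemma expansion_scaleR:
  assumes "x \<in> closed_span X"
  shows "expansion X (c *\<^sub>R x) = (\<lambda>k. c *\<^sub>R expansion X x k)"
  using assms
  by (intro expansion_unique sums_scaleR_right expansion_sums
      subspace_scale[OF schauder_subspace] expansion_mem subspace_scale[OF subspace_closed_span])

text \<open>Padding with zeros is itself an expansion, so uniqueness applies. This carries estimates
  on \<open>closed_span X\<close> over to the finite families in the definition of
  \<open>absolute\<close>.\<close>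

lemma expansion_finite_sum:
  assumes "\<And>k. k < m \<Longrightarrow> x k \<in> X k"
  shows "expansion X (\<Sum>k<m. x k) = (\<lambda>k. if k < m then x k else 0)"
proof (rule expansion_unique)
  show "(\<Sum>k<m. x k) \<in> closed_span X"
    using assms by (intro sum_mem_closed_span) auto
  show "(if k < m then x k else 0) \<in> X k" for k
    using assms subspace_0[OF schauder_subspace] by auto
  have "(\<lambda>k. if k < m then x k else 0) sums (\<Sum>k | k < m. x k)"
    by (rule sums_If_finite) simp
  then show "(\<lambda>k. if k < m then x k else 0) sums (\<Sum>k<m. x k)"
    by (simp add: lessThan_def)
qed

text \<open>Uniformly bounded linear partial-sum maps are Lipschitz, and a coordinate is the
  difference of two consecutive ones.\<close>

lemma continuous_on_expansion:
  assumes bound: "\<And>n x. x \<in> closed_span X \<Longrightarrow> norm (\<Sum>k<n. expansion X x k) \<le> M * norm x"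
  shows "continuous_on (closed_span X) (\<lambda>x. expansion X x k)"
proof -
  define P where "P n x = (\<Sum>k<n. expansion X x k)" for n x
  have diff: "P n x - P n y = P n (x - y)"
    if "x \<in> closed_span X" "y \<in> closed_span X" for n x y
    using that expansion_add[of x "(-1) *\<^sub>R y"] expansion_scaleR[of y "-1"]
      subspace_scale[OF subspace_closed_span, of y X "-1"]
    by (simp add: P_def sum_subtractf)
  have P: "continuous_on (closed_span X) (P n)" for n
  proof (rule lipschitz_on_continuous_on)
    \<comment> \<open>A Lipschitz constant must be nonnegative, and the sign of \<open>M\<close> is
      not assumed.\<close>
    show "\<bar>M\<bar>-lipschitz_on (closed_span X) (P n)"
    proof (rule lipschitz_onI)
      fix x y assume xy: "x \<in> closed_span X" "y \<in> closed_span X"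
      then have "dist (P n x) (P n y) \<le> M * norm (x - y)"
        using bound[OF subspace_diff[OF subspace_closed_span xy], of n]
        by (simp add: dist_norm diff) (simp add: P_def)
      also have "\<dots> \<le> \<bar>M\<bar> * dist x y"
        by (simp add: dist_norm mult_right_mono)
      finally show "dist (P n x) (P n y) \<le> \<bar>M\<bar> * dist x y" .
    qed simp
  qed
  show ?thesis
    using continuous_on_diff[OF P[of "Suc k"] P[of k]] by (simp add: P_def)
qed

end

section \<open>Bidecompositions\<close>

text \<open>For \<open>n \<le> m\<close> the \<open>n\<close>-th partial sum is dominated by the
  supremum up to \<open>m\<close>, so its norm is at most \<open>M\<close> times that of the
  \<open>m\<close>-th; then \<open>m\<close> tends to infinity.\<close>

lemma bidecomposition_partial_sum_bound:
  fixes X :: "nat \<Rightarrow> 'a::banach_lattice set"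
  assumes "bidecomposition X"
  shows "\<exists>M. \<forall>n. \<forall>x\<in>closed_span X. norm (\<Sum>k<n. expansion X x k) \<le> M * norm x"
proof -
  from assms have X: "schauder_decomposition X" by (simp add: bidecomposition_def)
  from assms obtain M where M: "M \<ge> 1"
    "\<And>m x. m \<ge> 1 \<Longrightarrow> (\<forall>k<m. x k \<in> X k) \<Longrightarrow>
      norm (Sup_fin ((\<lambda>n. \<bar>\<Sum>k<n. x k\<bar>) ` {1..m})) \<le> M * norm (\<Sum>k<m. x k)"
    unfolding bidecomposition_def by blast
  have "norm (\<Sum>k<n. expansion X x k) \<le> M * norm x" if x: "x \<in> closed_span X" for n x
  \<comment> \<open>The suprema range over \<open>{1..m}\<close>, so the empty partial sum is
    treated separately.\<close>
  proof (cases "n = 0")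
    case True
    then show ?thesis using M(1) by simp
  next
    case False
    let ?e = "expansion X x"
    have "norm (\<Sum>k<n. ?e k) \<le> M * norm (\<Sum>k<m. ?e k)" if "n \<le> m" for m
    proof -
      have "\<bar>\<Sum>k<n. ?e k\<bar> \<le> Sup_fin ((\<lambda>n. \<bar>\<Sum>k<n. ?e k\<bar>) ` {1..m})"
        using False that by (intro Sup_fin.coboundedI) auto
      then have "norm (\<Sum>k<n. ?e k) \<le> norm (Sup_fin ((\<lambda>n. \<bar>\<Sum>k<n. ?e k\<bar>) ` {1..m}))"
        by (rule norm_le_of_abs_le)
      also have "\<dots> \<le> M * norm (\<Sum>k<m. ?e k)"
        using False that x by (intro M) (auto intro: expansion_mem[OF X])
      finally show ?thesis .
    qed
    then have "\<forall>\<^sub>F m in sequentially. norm (\<Sum>k<n. ?e k) \<le> M * norm (\<Sum>k<m. ?e k)"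
      using eventually_ge_at_top[of n] by (rule eventually_mono[rotated])
    moreover have "(\<lambda>m. M * norm (\<Sum>k<m. ?e k)) \<longlonglongrightarrow> M * norm x"
      using expansion_sums[OF X x] unfolding sums_def by (intro tendsto_intros)
    ultimately show ?thesis
      by (intro tendsto_lowerbound[OF _ _ trivial_limit_sequentially])
  qed
  then show ?thesis by blast
qed

section \<open>From absoluteness to order bounds\<close>

text \<open>Absoluteness, applied to blocks \<open>m..<n\<close>, transfers the Cauchy criterion
  from \<open>x\<close> to its moduli.\<close>

lemma absolute_imp_summable_abs:
  fixes X :: "nat \<Rightarrow> 'a::banach_lattice set"
  assumes "absolute X" and subspaces: "\<And>k. subspace (X k)"
    and x: "\<And>k. x k \<in> X k" and "summable x"
  shows "summable (\<lambda>k. \<bar>x k\<bar>)"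
proof -
  from assms(1) obtain A where A: "A \<ge> 1"
    "\<And>m x. m \<ge> 1 \<Longrightarrow> (\<forall>k<m. x k \<in> X k) \<Longrightarrow>
      norm (\<Sum>k<m. \<bar>x k\<bar>) \<le> A * norm (\<Sum>k<m. x k)"
    unfolding absolute_def by blast
  have block: "norm (\<Sum>k=m..<n. \<bar>x k\<bar>) \<le> A * norm (\<Sum>k=m..<n. x k)" for m n
  proof (cases "n = 0")
    case False
    \<comment> \<open>Absoluteness speaks of initial segments only; replacing the first
      \<open>m\<close> terms by zero, which lies in each subspace, turns a block into one.\<close>
    define z where "z k = (if m \<le> k then x k else 0)" for k
    have "(\<Sum>k<n. z k) = (\<Sum>k=m..<n. x k)" "(\<Sum>k<n. \<bar>z k\<bar>) = (\<Sum>k=m..<n. \<bar>x k\<bar>)"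
      by (rule sum.mono_neutral_cong_right; auto simp: z_def)+
    moreover have "norm (\<Sum>k<n. \<bar>z k\<bar>) \<le> A * norm (\<Sum>k<n. z k)"
      using False x subspace_0[OF subspaces] by (intro A) (auto simp: z_def)
    ultimately show ?thesis by simp
  qed simp
  show ?thesis
    unfolding summable_Cauchy
  proof (intro allI impI)
    fix e :: real assume "e > 0"
    then have "e / A > 0" using A(1) by simp
    then obtain N where N: "\<And>m n. m \<ge> N \<Longrightarrow> norm (sum x {m..<n}) < e / A"
      using \<open>summable x\<close> unfolding summable_Cauchy by blast
    have "norm (\<Sum>k=m..<n. \<bar>x k\<bar>) < e" if "m \<ge> N" for m n
      using block[of m n] N[OF that, of n] A(1) by (simp add: field_simps)
    then show "\<exists>N. \<forall>m\<ge>N. \<forall>n. norm (\<Sum>k=m..<n. \<bar>x k\<bar>) < e" by blast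
  qed
qed

lemma absolute_imp_order_bounded:
  fixes X :: "nat \<Rightarrow> 'a::banach_lattice set"
  assumes X: "schauder_decomposition X" and "absolute X" and x: "x \<in> closed_span X"
  shows "\<exists>u\<ge>0. \<forall>n \<sigma>. bij \<sigma> \<longrightarrow> \<bar>perm_projection X \<sigma> n x\<bar> \<le> u"
proof (intro exI conjI allI impI)
  let ?e = "expansion X x" and ?u = "\<Sum>k. \<bar>expansion X x k\<bar>"
  have summable: "summable (\<lambda>k. \<bar>?e k\<bar>)"
    using \<open>absolute X\<close> schauder_subspace[OF X] expansion_mem[OF X x]
      sums_summable[OF expansion_sums[OF X x]]
    by (rule absolute_imp_summable_abs)
  note le = sum_le_suminf_lattice[OF summable abs_ge_zero]
  show "0 \<le> ?u" using le[of 0] by simp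
  fix n and \<sigma> :: "nat \<Rightarrow> nat" assume "bij \<sigma>"
  then have inj: "inj_on \<sigma> {..<n}" by (meson bij_is_inj inj_on_subset subset_UNIV)
  \<comment> \<open>The finitely many permuted indices lie in an initial segment, so one ordinary
    partial sum of moduli dominates, whatever the permutation.\<close>
  obtain N where N: "\<sigma> ` {..<n} \<subseteq> {..<N}"
    using finite_nat_bounded[of "\<sigma> ` {..<n}"] by auto
  have "\<bar>perm_projection X \<sigma> n x\<bar> \<le> (\<Sum>i<n. \<bar>?e (\<sigma> i)\<bar>)"
    unfolding perm_projection_def by (rule sum_abs)
  also have "\<dots> = (\<Sum>k\<in>\<sigma> ` {..<n}. \<bar>?e k\<bar>)"
    using inj by (simp add: sum.reindex)
  also have "\<dots> \<le> (\<Sum>k<N. \<bar>?e k\<bar>)"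
    using N by (intro sum_mono2) auto
  also have "\<dots> \<le> ?u" by (rule le)
  finally show "\<bar>perm_projection X \<sigma> n x\<bar> \<le> ?u" .
qed

section \<open>From order bounds to absoluteness\<close>

text \<open>Each finite subset sum is a permuted partial sum, hence has modulus at most
  \<open>u\<close>. The resulting bound is independent of \<open>m\<close>, as pointwise boundedness
  of the seminorms requires.\<close>

lemma order_bounded_imp_sum_abs_bounded:
  fixes X :: "nat \<Rightarrow> 'a::banach_lattice set"
  assumes u: "\<And>n \<sigma>. bij \<sigma> \<Longrightarrow> \<bar>perm_projection X \<sigma> n x\<bar> \<le> u"
  shows "norm (\<Sum>k<m. \<bar>expansion X x k\<bar>) \<le> norm (u + u)"
proof -
  have "\<bar>sum (expansion X x) F\<bar> \<le> u" if "finite F" for F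
  proof -
    obtain \<sigma> where \<sigma>: "bij \<sigma>" "\<sigma> ` {..<card F} = F"
      using ex_bij_image_lessThan_card[OF \<open>finite F\<close>] by blast
    have "inj_on \<sigma> {..<card F}"
      using \<sigma>(1) by (meson bij_is_inj inj_on_subset subset_UNIV)
    then have "perm_projection X \<sigma> (card F) x = sum (expansion X x) F"
      using sum.reindex[of \<sigma> "{..<card F}" "expansion X x"] \<sigma>(2)
      by (simp add: perm_projection_def)
    then show ?thesis using u[OF \<sigma>(1)] by metis
  qed
  then have "(\<Sum>k<m. \<bar>expansion X x k\<bar>) \<le> u + u"
    using finite_subset by (intro sum_abs_le_of_subset_sums_le) blast+
  then show ?thesis
    by (intro norm_le_of_abs_le) (simp add: abs_of_nonneg sum_nonneg)
qed

text \<open>The bound \<open>u\<close> depends on \<open>x\<close>; uniform boundedness replaces it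
  by one constant. The bidecomposition inequality enters through continuity of the coordinates,
  hence of the seminorms \<open>p m\<close>.\<close>

lemma order_bounded_imp_absolute:
  fixes X :: "nat \<Rightarrow> 'a::banach_lattice set"
  assumes bi: "bidecomposition X"
    and bounded: "\<And>x. x \<in> closed_span X \<Longrightarrow>
      \<exists>u. \<forall>n \<sigma>. bij \<sigma> \<longrightarrow> \<bar>perm_projection X \<sigma> n x\<bar> \<le> u"
  shows "absolute X"
proof -
  from bi have X: "schauder_decomposition X" by (simp add: bidecomposition_def)
  obtain M where M: "\<And>n x. x \<in> closed_span X \<Longrightarrow> norm (\<Sum>k<n. expansion X x k) \<le> M * norm x"
    using bidecomposition_partial_sum_bound[OF bi] by blast
  define p where "p m x = norm (\<Sum>k<m. \<bar>expansion X x k\<bar>)" for m x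
  have "\<exists>C. \<forall>m. \<forall>x\<in>closed_span X. p m x \<le> C * norm x"
  proof (rule seminorms_uniformly_bounded[OF closed_closed_span subspace_closed_span])
    show "continuous_on (closed_span X) (p m)" for m
      unfolding p_def
      by (intro continuous_intros continuous_on_abs_lattice continuous_on_expansion[OF X M])
  next
    fix m x y assume xy: "x \<in> closed_span X" "y \<in> closed_span X"
    have "p m (x + y) \<le> norm ((\<Sum>k<m. \<bar>expansion X x k\<bar>) + (\<Sum>k<m. \<bar>expansion X y k\<bar>))"
      unfolding p_def expansion_add[OF X xy] sum.distrib[symmetric]
      by (intro norm_le_of_abs_le)
        (auto simp: abs_of_nonneg sum_nonneg intro!: sum_mono abs_triangle_ineq)
    also have "\<dots> \<le> p m x + p m y"
      unfolding p_def by (rule norm_triangle_ineq)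
    finally show "p m (x + y) \<le> p m x + p m y" .
  next
    fix m c x assume "x \<in> closed_span X"
    then show "p m (c *\<^sub>R x) = \<bar>c\<bar> * p m x"
      by (simp add: p_def expansion_scaleR[OF X] abs_scaleR_lattice flip: scaleR_sum_right)
  next
    fix x assume "x \<in> closed_span X"
    then show "\<exists>B. \<forall>m. p m x \<le> B"
      unfolding p_def using bounded order_bounded_imp_sum_abs_bounded by metis
  qed
  then obtain C where C: "\<And>m x. x \<in> closed_span X \<Longrightarrow> p m x \<le> C * norm x"
    by blast
  \<comment> \<open>The constant in \<open>absolute\<close> has to be at least 1, hence the
    maximum.\<close>
  have "norm (\<Sum>k<m. \<bar>x k\<bar>) \<le> max 1 C * norm (\<Sum>k<m. x k)" if "\<forall>k<m. x k \<in> X k" for m x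
  proof -
    have "norm (\<Sum>k<m. \<bar>x k\<bar>) = p m (\<Sum>k<m. x k)"
      using that by (simp add: p_def expansion_finite_sum[OF X])
    also have "\<dots> \<le> C * norm (\<Sum>k<m. x k)"
      using that by (intro C sum_mem_closed_span) auto
    also have "\<dots> \<le> max 1 C * norm (\<Sum>k<m. x k)"
      by (intro mult_right_mono) auto
    finally show ?thesis .
  qed
  then show ?thesis
    unfolding absolute_def by (intro exI[of _ "max 1 C"]) auto
qed

theorem proposition7p5:
  fixes X :: "nat \<Rightarrow> 'a::banach_lattice set"
  assumes "bidecomposition X"
  shows "absolute X \<longleftrightarrow>
    (\<forall>x\<in>closed_span X. \<exists>u\<ge>0. \<forall>n \<sigma>. bij \<sigma> \<longrightarrow> \<bar>perm_projection X \<sigma> n x\<bar> \<le> u)"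
proof
  assume "absolute X"
  moreover have "schauder_decomposition X"
    using assms by (simp add: bidecomposition_def)
  ultimately show "\<forall>x\<in>closed_span X. \<exists>u\<ge>0. \<forall>n \<sigma>. bij \<sigma> \<longrightarrow>
      \<bar>perm_projection X \<sigma> n x\<bar> \<le> u"
    using absolute_imp_order_bounded by blast
next
  assume "\<forall>x\<in>closed_span X. \<exists>u\<ge>0. \<forall>n \<sigma>. bij \<sigma> \<longrightarrow> \<bar>perm_projection X \<sigma> n x\<bar> \<le> u"
  then show "absolute X"
    by (intro order_bounded_imp_absolute[OF assms]) blast
qed

end
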